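(* Let $A$ be a Frobenius algebra over a field $\Bbbk$ with respect to a non-degenerate associative bilinear form $\langle-,-\rangle:A\times A\to\Bbbk$, with Nakayama automorphism $\sigma$. If $u:A\to A$ is an endomorphism of the algebra $A$, then there is exactly one element $\mathrm{jac}_\sigma(u)$ in $A$ such that $$\langle u(a),u(b)\rangle=\langle \mathrm{jac}_\sigma(u)\cdot a,b\rangle\qquad\text{for all }a,b\in A.$$
   Context: $\Bbbk$ is a field; algebras are associative and unital over $\Bbbk$. A Frobenius algebra is a finite-dimensional algebra $A$ endowed with a non-degenerate bilinear form $\langle-,-\rangle:A\times A\to\Bbbk$ that is associative: $\langle ab,c\rangle=\langle a,bc\rangle$ for all $a,b,c\in A$. Its Nakayama automorphism is the unique algebra automorphism $\sigma:A\to A$ such that $\langle a,b\rangle=\langle b,\sigma(a)\rangle$ for all $a,b\in A$. The element $\mathrm{jac}_\sigma(u)$ is called the Nakayama Jacobian of $u$. *)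

theory Defs
  imports Complex_Main
begin

text \<open>
  Algebras live on a type of class \<open>ring\<close> with the unit \<open>e\<close> as an explicit parameter. The class
  \<open>ring_1\<close> would impose \<open>0 \<noteq> 1\<close> and so exclude the zero algebra.
\<close>

locale unital_algebra = vector_space scale
  for scale :: "'k::field \<Rightarrow> 'a::ring \<Rightarrow> 'a" +
  fixes e :: 'a
  assumes scale_mult_left: "scale c a * b = scale c (a * b)"
    and scale_mult_right: "a * scale c b = scale c (a * b)"
    and unit_left: "e * a = a"
    and unit_right: "a * e = a"

definition algebra_endomorphism ::
  "('k::field \<Rightarrow> 'a::ring \<Rightarrow> 'a) \<Rightarrow> 'a \<Rightarrow> ('a \<Rightarrow> 'a) \<Rightarrow> bool" where
  "algebra_endomorphism scale e u \<longleftrightarrow>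
     Vector_Spaces.linear scale scale u \<and> (\<forall>a b. u (a * b) = u a * u b) \<and> u e = e"

definition algebra_automorphism ::
  "('k::field \<Rightarrow> 'a::ring \<Rightarrow> 'a) \<Rightarrow> 'a \<Rightarrow> ('a \<Rightarrow> 'a) \<Rightarrow> bool" where
  "algebra_automorphism scale e u \<longleftrightarrow> algebra_endomorphism scale e u \<and> bij u"

definition bilinear_form ::
  "('k::field \<Rightarrow> 'a::ab_group_add \<Rightarrow> 'a) \<Rightarrow> ('a \<Rightarrow> 'a \<Rightarrow> 'k) \<Rightarrow> bool" where
  "bilinear_form scale form \<longleftrightarrow>
     (\<forall>a. Vector_Spaces.linear scale (*) (\<lambda>b. form a b)) \<and>
     (\<forall>b. Vector_Spaces.linear scale (*) (\<lambda>a. form a b))"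

definition nondegenerate :: "('a::zero \<Rightarrow> 'a \<Rightarrow> 'k::zero) \<Rightarrow> bool" where
  "nondegenerate form \<longleftrightarrow>
     (\<forall>a. (\<forall>b. form a b = 0) \<longrightarrow> a = 0) \<and>
     (\<forall>b. (\<forall>a. form a b = 0) \<longrightarrow> b = 0)"

locale frobenius_algebra = unital_algebra scale e
  for scale :: "'k::field \<Rightarrow> 'a::ring \<Rightarrow> 'a" and e :: 'a +
  fixes form :: "'a \<Rightarrow> 'a \<Rightarrow> 'k"
  assumes finite_dimensional: "\<exists>B. finite_dimensional_vector_space scale B"
    and bilinear: "bilinear_form scale form"
    and nondegenerate: "nondegenerate form"
    and associative: "form (a * b) c = form a (b * c)"

definition nakayama_automorphism ::
  "('k::field \<Rightarrow> 'a::ring \<Rightarrow> 'a) \<Rightarrow> 'a \<Rightarrow> ('a \<Rightarrow> 'a \<Rightarrow> 'k) \<Rightarrow> ('a \<Rightarrow> 'a) \<Rightarrow> bool" where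
  "nakayama_automorphism scale e form \<sigma> \<longleftrightarrow>
     algebra_automorphism scale e \<sigma> \<and> (\<forall>a b. form a b = form b (\<sigma> a))"

end

theory Submission
  imports Defs
begin

text \<open>
  Associativity gives \<open>\<langle>u a, u b\<rangle> = \<langle>1, u (a b)\<rangle>\<close>, a linear functional of the product \<open>a b\<close>. By
  non-degeneracy and finite dimension it is represented as \<open>\<langle>j, a b\<rangle> = \<langle>j a, b\<rangle>\<close> for a unique \<open>j\<close>.
\<close>

text \<open>Non-degeneracy in the first argument makes \<open>j \<mapsto> form j\<close> an
  injective map into the dual space. The dual has the same finite dimension, so the map is also
  onto.\<close>

lemma (in finite_dimensional_vector_space) nondegenerate_form_represents_functional:
  assumes bilinear: "bilinear_form scale form"
    and nondegenerate: "nondegenerate form"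
    and functional: "Vector_Spaces.linear scale (*) f"
  shows "\<exists>j. \<forall>x. form j x = f x"
proof -
  \<comment> \<open>The field is viewed as a vector space over itself, so that functionals count as
    linear maps.\<close>
  interpret P: vector_space_pair scale "(*) :: 'a \<Rightarrow> 'a \<Rightarrow> 'a"
    using functional by (simp add: Vector_Spaces.linear_iff vector_space_pair_def)
  have right: "Vector_Spaces.linear scale (*) (form a)" for a
    using bilinear by (simp add: bilinear_form_def)
  have left: "Vector_Spaces.linear scale (*) (\<lambda>a. form a b)" for b
    using bilinear by (simp add: bilinear_form_def)
  have agree: "form a x = g x"
    if "Vector_Spaces.linear scale (*) g" "\<And>b. b \<in> Basis \<Longrightarrow> form a b = g b" for a g x
    using P.linear_eq_on[OF right that(1), of x Basis] that(2) span_Basis by simp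
  \<comment> \<open>\<open>T\<close> replaces the map \<open>j \<mapsto> form j\<close> into the dual space by an endomorphism, using
    the values of \<open>form j\<close> on the basis as coordinates.\<close>
  define T where "T j = (\<Sum>b\<in>Basis. scale (form j b) b)" for j
  have lin: "Vector_Spaces.linear scale scale T"
    unfolding Vector_Spaces.linear_iff T_def
    by (simp add: vector_space_axioms P.linear_add[OF left] P.linear_scale[OF left]
        scale_left_distrib sum.distrib scale_sum_right)
  have coords: "c b = d b"
    if "(\<Sum>b\<in>Basis. scale (c b) b) = (\<Sum>b\<in>Basis. scale (d b) b)" "b \<in> Basis" for c d b
  proof -
    have "(\<Sum>b\<in>Basis. scale (c b - d b) b) = 0"
      using that(1) by (simp add: scale_left_diff_distrib sum_subtractf)
    then have "c b - d b = 0"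
      using independentD[OF independent_Basis finite_Basis subset_refl, of "\<lambda>b. c b - d b"] that(2) by blast
    then show ?thesis by simp
  qed
  have "inj T"
  proof (rule injI)
    fix x y assume "T x = T y"
    then have "form x b = form y b" if "b \<in> Basis" for b
      using coords that unfolding T_def by blast
    then have "form x z = form y z" for z
      using agree[OF right] by blast
    then have "form (x - y) z = 0" for z
      by (simp add: P.linear_diff[OF left])
    then have "x - y = 0"
      using nondegenerate unfolding nondegenerate_def by blast
    then show "x = y" by simp
  qed
  \<comment> \<open>An injective endomorphism of a finite-dimensional space is onto.\<close>
  then have "surj T"
    using lin linear_inj_imp_surj by blast
  \<comment> \<open>The target vector has the values of \<open>f\<close> on \<open>Basis\<close> as
    coordinates, so any preimage \<open>j\<close> gives a functional \<open>form j\<close> that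
    matches \<open>f\<close> on \<open>Basis\<close>.\<close>
  then obtain j where "T j = (\<Sum>b\<in>Basis. scale (f b) b)"
    by (metis surjD)
  then have "form j b = f b" if "b \<in> Basis" for b
    using coords that unfolding T_def by blast
  then show ?thesis
    using agree[OF functional] by blast
qed

theorem proposition2:
  fixes scale :: "'k::field \<Rightarrow> 'a::ring \<Rightarrow> 'a"
    and e :: 'a
    and form :: "'a \<Rightarrow> 'a \<Rightarrow> 'k"
    and \<sigma> u :: "'a \<Rightarrow> 'a"
  assumes "frobenius_algebra scale e form"
    and "nakayama_automorphism scale e form \<sigma>"
    and "algebra_endomorphism scale e u"
  shows "\<exists>!j. \<forall>a b. form (u a) (u b) = form (j * a) b"
proof -
  interpret frobenius_algebra scale e form by fact
  obtain B where "finite_dimensional_vector_space scale B"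
    using finite_dimensional by blast
  then interpret F: finite_dimensional_vector_space scale B .
  have u_linear: "Vector_Spaces.linear scale scale u"
    and u_mult: "u (a * b) = u a * u b" for a b
    using assms(3) by (auto simp: algebra_endomorphism_def)
  have right: "Vector_Spaces.linear scale (*) (form a)"
    and left: "Vector_Spaces.linear scale (*) (\<lambda>a. form a b)" for a b
    using bilinear by (auto simp: bilinear_form_def)
  have "Vector_Spaces.linear scale (*) (\<lambda>x. form e (u x))"
    using Vector_Spaces.linear_compose[OF u_linear right] by (simp add: o_def)
  then obtain j where j: "\<And>x. form j x = form e (u x)"
    using F.nondegenerate_form_represents_functional[OF bilinear nondegenerate] by blast
  have form_product: "form (u a) (u b) = form e (u (a * b))" for a b
    by (metis associative u_mult unit_left)
  show ?thesis
  proof (rule ex1I[of _ j])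
    show "\<forall>a b. form (u a) (u b) = form (j * a) b"
      by (simp add: associative j form_product)
  next
    fix k assume k: "\<forall>a b. form (u a) (u b) = form (k * a) b"
    \<comment> \<open>Setting \<open>a = e\<close> turns the identity for \<open>k\<close> into
      \<open>form k b = form e (u b)\<close>, the functional that \<open>j\<close>
      represents.\<close>
    have "form k b = form j b" for b
      using k form_product[of e b] by (metis j unit_left unit_right)
    then have "form (k - j) b = 0" for b
      using module_hom.diff[OF left[unfolded linear_iff_module_hom]] by simp
    then have "k - j = 0"
      using nondegenerate unfolding nondegenerate_def by blast
    then show "k = j" by simp
  qed
qed

end
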